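(* For an incompressible fluid in two dimensions, let $\omega:\mathbb{R}^2\to\mathbb{R}$ be a vorticity field such that $\int_{\mathbb{R}^2}\omega\,dx=0$, and $\|\omega\|_{L^2(\mathbb{R}^2)}$ and $\int_{\mathbb{R}^2}|x|\,|\omega(x)|\,dx$ are both finite. Let the associated velocity field $u:\mathbb{R}^2\to\mathbb{R}^2$ be defined by $$u(x)=\frac{1}{2\pi}\int_{\mathbb{R}^2}\frac{(x-y)^\perp}{|x-y|^2}\,\omega(y)\,dy.$$ Then the kinetic energy of the fluid is finite, i.e., $\|u\|_{L^2(\mathbb{R}^2)}<\infty$. In particular, $$\|u\|_{L^2(\mathbb{R}^2)}<\|\omega\|_{L^2(\mathbb{R}^2)}^{1/2}\,\|x\,\omega\|_{L^1(\mathbb{R}^2)}^{1/2}$$ (with both sides equal to $0$ in the trivial case $\omega=0$ almost everywhere).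
   Context: For $z=(z_1,z_2)\in\mathbb{R}^2$, $z^\perp=(-z_2,z_1)$ denotes rotation by a right angle, so that the formula for $u$ is the two-dimensional Biot–Savart law, giving $\nabla\cdot u=0$ and $\nabla\times u=\partial_1u_2-\partial_2u_1=\omega$. Here $\|x\,\omega\|_{L^1(\mathbb{R}^2)}=\int_{\mathbb{R}^2}|x|\,|\omega(x)|\,dx$. *)

theory Defs
  imports "HOL-Analysis.Analysis"
begin

definition perp :: "real ^ 2 \<Rightarrow> real ^ 2" where
  "perp z = vector [- (z $ 2), z $ 1]"

(* The Bochner integral is 0 at points x where the integrand is not absolutely integrable. *)
definition biot_savart :: "(real ^ 2 \<Rightarrow> real) \<Rightarrow> real ^ 2 \<Rightarrow> real ^ 2" where
  "biot_savart \<omega> x =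
     (1 / (2 * pi)) *\<^sub>R (\<integral>y. \<omega> y *\<^sub>R ((1 / (norm (x - y))\<^sup>2) *\<^sub>R perp (x - y)) \<partial>lebesgue)"

definition square_integrable :: "(real ^ 2 \<Rightarrow> 'b::euclidean_space) \<Rightarrow> bool" where
  "square_integrable f \<longleftrightarrow>
     f \<in> borel_measurable lebesgue \<and> integrable lebesgue (\<lambda>x. (norm (f x))\<^sup>2)"

(* Real-valued, so it is the L2 norm only for functions that are square_integrable. *)
definition L2_norm :: "(real ^ 2 \<Rightarrow> 'b::euclidean_space) \<Rightarrow> real" where
  "L2_norm f = sqrt (\<integral>x. (norm (f x))\<^sup>2 \<partial>lebesgue)"

end

theory Submission
  imports Defs
begin

text \<open>
  Split the kernel $K(z) = z^\perp/|z|^2$ as $K = K_1 + K_2$, where $K_2$ is the velocity field of a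
  mollified point vortex with core radius $\sqrt q$, so that $K_1$ is supported in the core.
  By Young's inequality $\|K_1 * \omega\|_2 \le \|K_1\|_1 \|\omega\|_2$, and $\|K_1\|_1$ is of order
  $\sqrt q$. As $\omega$ has mean zero, $K_2 * \omega(x) = \int (K_2(x-y) - K_2(x))\,\omega(y)\,dy$;
  since $\|K_2(\cdot - y) - K_2\|_2 \le C |y|/\sqrt q$, the Cauchy--Schwarz inequality bounds
  $\|K_2 * \omega\|_2$ by $C \|x\,\omega\|_1/\sqrt q$. Balancing the two terms in $q$ gives the claim.
\<close>

text \<open>The kernel has size 1/|z|: its square is not integrable at 0 or at infinity, and the
  kernel itself is not integrable at infinity, so no single convolution inequality covers both ends.
  Removing a core leaves an integrable K_1 that carries the singularity. For fixed y the differences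
  K_2(x-y) - K_2(x) decay like 1/|x|^2, which is square integrable at infinity; mean zero is what
  allows K_2 to be replaced by these differences.

  Strictness does not come from equality cases. The bound holds with a numerical constant below 1,
  and the margin is small, so the radial integrals are evaluated exactly and the intermediate
  inequalities are chosen to lose almost nothing. By scaling, q has the dimension of a squared
  length, as has the ratio of the first moment of the vorticity to its L^2 norm; the final q is a
  multiple of this ratio.

  The estimates are stated for Borel functions and nonnegative extended integrals, so that Tonelli
  applies before any convergence is known. A Lebesgue measurable vorticity enters only at the end,
  through a Borel representative.\<close>

section \<open>Radial integrals in the plane\<close>

lemma emeasure_lborel_cball_2:
  fixes c :: "real ^ 2"
  assumes "0 \<le> r"
  shows "emeasure lborel (cball c r) = ennreal (pi * r\<^sup>2)"
  using emeasure_cball[OF assms, of c] by (simp add: unit_ball_vol_2)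

text \<open>A disc of squared radius t has area pi * t, so the squared norm pushes planar measure to
  the constant density pi on the half-line. Integrating in s = |z|^2 instead of |z| avoids polar
  coordinates and a Jacobian.\<close>

lemma distr_norm_square:
  "distr lborel borel (\<lambda>x :: real ^ 2. (norm x)\<^sup>2) = density lborel (\<lambda>s. ennreal pi * indicator {0..} s)"
  (is "?M = ?N")
proof (rule measure_eqI_generator_eq)
  let ?E = "range (\<lambda>(a, b). {a <.. b::real})"
  have "{a<..b} \<inter> {c<..d} = {max a c<..min b d}" for a b c d :: real by auto
  then show "Int_stable ?E" by (auto simp: Int_stable_def)
  show "?E \<subseteq> Pow UNIV" "sets ?M = sigma_sets UNIV ?E" "sets ?N = sigma_sets UNIV ?E"
    by (simp_all add: borel_sigma_sets_Ioc)
  let ?A = "\<lambda>n::nat. {- real n <.. real n}"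
  show "range ?A \<subseteq> ?E" by auto
  have "\<exists>n::nat. - real n < x \<and> x \<le> real n" for x
    using reals_Archimedean2[of "\<bar>x\<bar>"] by (metis abs_less_iff less_imp_le minus_less_iff)
  then show "(\<Union>i. ?A i) = UNIV" by auto
  have cb: "{x :: real^2. (norm x)\<^sup>2 \<le> t} = cball 0 (sqrt t)" if "0 \<le> t" for t
    using that by (auto simp: real_le_rsqrt sqrt_le_D dist_norm real_sqrt_le_iff power2_eq_square)
      (metis norm_ge_zero power2_eq_square real_sqrt_pow2 sqrt_le_D real_le_rsqrt power_mono)
  have M0: "emeasure lborel {x :: real^2. (norm x)\<^sup>2 \<le> t} = ennreal (pi * max 0 t)" for t
  proof (cases "0 \<le> t")
    case True
    then show ?thesis by (simp add: cb emeasure_lborel_cball_2)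
  next
    case False
    then have "{x :: real^2. (norm x)\<^sup>2 \<le> t} = {}"
      using zero_le_power2 order.trans by blast
    then show ?thesis using False by (simp add: max_def)
  qed
  \<comment> \<open>\<open>max 0\<close> truncates the end points at 0, below which neither measure
    has mass.\<close>
  have key: "emeasure ?M {a<..b} = ennreal (pi * (max 0 b - max 0 a)) \<and>
      emeasure ?N {a<..b} = ennreal (pi * (max 0 b - max 0 a))" if "a \<le> b" for a b :: real
  proof
    have "emeasure ?M {a<..b} = emeasure lborel ({x :: real^2. (norm x)\<^sup>2 \<le> b} - {x. (norm x)\<^sup>2 \<le> a})"
      by (subst emeasure_distr) (auto intro!: arg_cong[where f="emeasure lborel"])
    also have "\<dots> = ennreal (pi * max 0 b) - ennreal (pi * max 0 a)"
      using that by (subst emeasure_Diff) (auto simp: M0)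
    also have "\<dots> = ennreal (pi * (max 0 b - max 0 a))"
      by (simp add: ennreal_minus right_diff_distrib)
    finally show "emeasure ?M {a<..b} = \<dots>" .
    have "emeasure ?N {a<..b} = (\<integral>\<^sup>+s. ennreal pi * indicator ({a<..b} \<inter> {0..}) s \<partial>lborel)"
      by (subst emeasure_density) (auto intro!: nn_integral_cong split: split_indicator)
    also have "\<dots> = ennreal pi * emeasure lborel ({a<..b} \<inter> {0..})"
      by (subst nn_integral_cmult_indicator) auto
    also have "emeasure lborel ({a<..b} \<inter> {0..}) = ennreal (max 0 b - max 0 a)"
    proof (cases "a < 0")
      case True
      then have "{a<..b} \<inter> {0..} = {0..b}" by auto
      then show ?thesis using True by (auto simp: max_def)
    next
      case False
      then have "{a<..b} \<inter> {0..} = {a<..b}" by auto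
      then show ?thesis using False that by (auto simp: max_def)
    qed
    finally show "emeasure ?N {a<..b} = ennreal (pi * (max 0 b - max 0 a))"
      using that by (simp add: ennreal_mult max_def)
  qed
  show "emeasure ?M (?A i) \<noteq> \<infinity>" for i using key[of "- real i" "real i"] by simp
  fix X assume "X \<in> ?E"
  then obtain a b where "X = {a<..b}" by auto
  then show "emeasure ?M X = emeasure ?N X"
    using key[of a b] by (cases "a \<le> b") auto
qed

lemma nn_integral_norm_square:
  fixes f :: "real \<Rightarrow> ennreal"
  assumes [measurable]: "f \<in> borel_measurable borel"
  shows "(\<integral>\<^sup>+x. f ((norm (x :: real ^ 2))\<^sup>2) \<partial>lborel) = ennreal pi * (\<integral>\<^sup>+s\<in>{0..}. f s \<partial>lborel)"
proof -
  have "(\<integral>\<^sup>+x. f ((norm (x :: real ^ 2))\<^sup>2) \<partial>lborel) =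
      (\<integral>\<^sup>+s. f s \<partial>distr lborel borel (\<lambda>x :: real ^ 2. (norm x)\<^sup>2))"
    by (subst nn_integral_distr) auto
  also have "\<dots> = (\<integral>\<^sup>+s. ennreal pi * (f s * indicator {0..} s) \<partial>lborel)"
    unfolding distr_norm_square by (subst nn_integral_density) (auto simp: mult_ac)
  finally show ?thesis by (simp add: nn_integral_cmult)
qed

section \<open>Rotation by a right angle, and invariance of integrals\<close>

lemma perp_nth [simp]: "perp z $ 1 = - (z $ 2)" "perp z $ 2 = z $ 1"
  by (simp_all add: perp_def)

lemma bounded_linear_perp: "bounded_linear perp"
  unfolding linear_conv_bounded_linear[symmetric]
  by (rule linearI) (auto simp: vec_eq_iff forall_2)

lemma norm_perp [simp]: "norm (perp z) = norm z"
  by (simp add: norm_eq_sqrt_inner inner_vec_def sum_2)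

lemma perp_inner_perp [simp]: "perp x \<bullet> perp y = x \<bullet> y"
  by (simp add: inner_vec_def sum_2)

lemma perp_add: "perp (x + y) = perp x + perp y"
  and perp_scaleR: "perp (c *\<^sub>R x) = c *\<^sub>R perp x"
  by (auto simp: vec_eq_iff forall_2)

lemma borel_measurable_perp [measurable]: "perp \<in> borel_measurable borel"
  by (intro borel_measurable_continuous_onI bounded_linear.continuous_on[OF bounded_linear_perp] continuous_on_id)

text \<open>Pythagoras for \<open>y\<close> in the orthogonal frame \<open>z\<close>,
  \<open>perp z\<close>, whose two vectors have equal length.\<close>

lemma inner_square_add_perp: "(z \<bullet> y)\<^sup>2 + (perp z \<bullet> y)\<^sup>2 = (norm z)\<^sup>2 * (norm y)\<^sup>2"
  by (simp add: inner_vec_def sum_2 power2_norm_eq_inner) (simp add: power2_eq_square algebra_simps)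

text \<open>A right angle takes axis-parallel boxes to axis-parallel boxes, so comparing box volumes
  suffices. Two directions are already enough to average a quadratic form in the plane, hence no
  other rotation is considered.\<close>

lemma distr_perp: "distr lborel borel perp = lborel"
proof (rule lborel_eqI[symmetric])
  fix l u :: "real^2" assume *: "\<And>b. b \<in> Basis \<Longrightarrow> l \<bullet> b \<le> u \<bullet> b"
  have le: "l $ 1 \<le> u $ 1" "l $ 2 \<le> u $ 2"
    using *[of "axis 1 1"] *[of "axis 2 1"] by (auto simp: inner_axis axis_in_Basis_iff)
  have P: "(\<Prod>b\<in>Basis. v \<bullet> b) = v $ 1 * v $ 2" for v :: "real^2"
    by (simp add: Basis_vec_def UNIV_2 inner_axis axis_eq_axis)
  have eq: "perp -` box l u = box (vector [l $ 2, - u $ 1]) (vector [u $ 2, - l $ 1])"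
    by (auto simp: mem_box_cart forall_2)
  have "emeasure (distr lborel borel perp) (box l u) = emeasure lborel (perp -` box l u)"
    by (subst emeasure_distr) auto
  also have "\<dots> = (\<Prod>b\<in>Basis. (vector [u $ 2, - l $ 1] - vector [l $ 2, - u $ 1] :: real^2) \<bullet> b)"
    unfolding eq using le
    by (subst emeasure_lborel_box) (auto simp: Basis_vec_def UNIV_2 inner_axis)
  also have "\<dots> = (\<Prod>b\<in>Basis. (u - l) \<bullet> b)"
    unfolding P by (simp add: mult.commute)
  finally show "emeasure (distr lborel borel perp) (box l u) = (\<Prod>b\<in>Basis. (u - l) \<bullet> b)" .
qed simp

lemma nn_integral_perp:
  fixes f :: "real ^ 2 \<Rightarrow> ennreal"
  assumes [measurable]: "f \<in> borel_measurable borel"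
  shows "(\<integral>\<^sup>+x. f (perp x) \<partial>lborel) = (\<integral>\<^sup>+x. f x \<partial>lborel)"
  by (subst (2) distr_perp[symmetric]) (simp add: nn_integral_distr)

lemma nn_integral_lborel_translate:
  fixes f :: "'a::euclidean_space \<Rightarrow> ennreal"
  assumes [measurable]: "f \<in> borel_measurable borel"
  shows "(\<integral>\<^sup>+x. f (x - a) \<partial>lborel) = (\<integral>\<^sup>+x. f x \<partial>lborel)"
  by (subst (2) lborel_distr_plus[symmetric, of "- a"]) (simp add: nn_integral_distr)

section \<open>The velocity of a mollified vortex and its gradient\<close>

text \<open>
  \<open>core_velocity q\<close> below is $2\pi$ times the velocity field induced by the compactly supported
  vorticity $\frac{2}{\pi q}(1 - |z|^2/q)_+$ of total mass 1, with $q$ the square of the core radius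
  and $s = |z|^2$. For a uniform core the constant of the final estimate would exceed 1;
  this one gives $(2048/(675\pi))^{1/4} < 1$.
\<close>

definition core_profile :: "real \<Rightarrow> real \<Rightarrow> real" where
  "core_profile q s = (if s \<le> q then (2 * q - s) / q\<^sup>2 else 1 / s)"

text \<open>The branches of \<open>core_profile\<close> have slopes -1/q^2 and -1/s^2, which agree
  at s = q, and \<open>max\<close> merges them. The profile is thus continuously differentiable, as
  the fundamental theorem of calculus along segments requires.\<close>

definition core_profile_deriv :: "real \<Rightarrow> real \<Rightarrow> real" where
  "core_profile_deriv q s = - 1 / (max s q)\<^sup>2"

lemma has_real_derivative_core_profile:
  assumes "0 < q"
  shows "(core_profile q has_real_derivative core_profile_deriv q s) (at s)"
proof -
  have left: "((\<lambda>s. (2 * q - s) / q\<^sup>2) has_real_derivative - 1 / q\<^sup>2) (at s within A)" for s A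
    using assms by (auto intro!: derivative_eq_intros simp: power2_eq_square)
  have right: "((\<lambda>s. 1 / s) has_real_derivative - 1 / s\<^sup>2) (at s within A)" if "s \<noteq> 0" for s A
    using that by (auto intro!: derivative_eq_intros simp: power2_eq_square)
  consider "s < q" | "s > q" | "s = q" by linarith
  then show ?thesis
  proof cases
    case 1
    have "(core_profile q has_real_derivative - 1 / q\<^sup>2) (at s)"
      by (rule has_field_derivative_transform_within_open[OF left, of "{..<q}"])
        (use 1 in \<open>simp_all add: core_profile_def\<close>)
    then show ?thesis using 1 by (simp add: core_profile_deriv_def max_def)
  next
    case 2
    have "(core_profile q has_real_derivative - 1 / s\<^sup>2) (at s)"
      by (rule has_field_derivative_transform_within_open[OF right, of _ "{q<..}"])
        (use 2 assms in \<open>simp_all add: core_profile_def\<close>)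
    then show ?thesis using 2 by (simp add: core_profile_deriv_def max_def)
  next
    case 3
    \<comment> \<open>At the edge of the core both branches have value 1/q and slope -1/q^2, so the
      one-sided derivatives can be glued.\<close>
    have "(core_profile q has_real_derivative - 1 / q\<^sup>2) (at q within {..q})"
      by (rule has_field_derivative_transform_within[OF left, of 1]) (auto simp: core_profile_def)
    moreover have "(core_profile q has_real_derivative - 1 / q\<^sup>2) (at q within {q..})"
      using assms by (intro has_field_derivative_transform_within[OF right, of _ 1])
        (auto simp: core_profile_def power2_eq_square)
    ultimately have "(core_profile q has_real_derivative - 1 / q\<^sup>2) (at q within {..q} \<union> {q..})"
      unfolding has_field_derivative_iff unfolding at_within_union by (rule filterlim_sup)
    moreover have "{..q} \<union> {q..} = UNIV" by auto
    ultimately show ?thesis using 3 by (simp add: core_profile_deriv_def)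
  qed
qed

lemma continuous_on_core_profile:
  assumes "0 < q" shows "continuous_on A (core_profile q)"
  by (intro continuous_at_imp_continuous_on ballI DERIV_isCont[OF has_real_derivative_core_profile[OF assms]])

lemma continuous_on_core_profile_deriv:
  assumes "0 < q" shows "continuous_on A (core_profile_deriv q)"
proof -
  have "max s q \<noteq> 0" for s using assms by (simp add: max_def)
  then show ?thesis unfolding core_profile_deriv_def by (auto intro!: continuous_intros)
qed

definition core_velocity :: "real \<Rightarrow> real ^ 2 \<Rightarrow> real ^ 2" where
  "core_velocity q z = core_profile q ((norm z)\<^sup>2) *\<^sub>R perp z"

text \<open>The directional derivative of \<open>core_velocity q\<close> at \<open>z\<close> in the
  direction \<open>y\<close>, expanded by the product and chain rules.\<close>

definition core_gradient :: "real \<Rightarrow> real ^ 2 \<Rightarrow> real ^ 2 \<Rightarrow> real ^ 2" where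
  "core_gradient q z y = core_profile q ((norm z)\<^sup>2) *\<^sub>R perp y +
     (2 * core_profile_deriv q ((norm z)\<^sup>2) * (z \<bullet> y)) *\<^sub>R perp z"

lemma continuous_on_perp [continuous_intros]:
  "continuous_on A f \<Longrightarrow> continuous_on A (\<lambda>x. perp (f x))"
  by (rule bounded_linear.continuous_on[OF bounded_linear_perp])

lemma continuous_on_core_gradient:
  assumes "0 < q" "continuous_on A f" "continuous_on A g"
  shows "continuous_on A (\<lambda>x. core_gradient q (f x) (g x))"
  unfolding core_gradient_def
  by (intro continuous_intros continuous_on_compose2[OF continuous_on_core_profile[OF assms(1), of UNIV]]
      continuous_on_compose2[OF continuous_on_core_profile_deriv[OF assms(1), of UNIV]] assms) auto

lemma has_vector_derivative_core_velocity:
  assumes "0 < q"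
  shows "((\<lambda>t. core_velocity q (x + t *\<^sub>R y)) has_vector_derivative core_gradient q (x + t *\<^sub>R y) y) (at t within A)"
proof -
  have 1: "((\<lambda>t. (norm (x + t *\<^sub>R y))\<^sup>2) has_real_derivative 2 * ((x + t *\<^sub>R y) \<bullet> y)) (at t within A)"
    unfolding power2_norm_eq_inner has_field_derivative_def
    by (auto intro!: derivative_eq_intros simp: fun_eq_iff inner_commute algebra_simps)
  have 2: "((\<lambda>t. core_profile q ((norm (x + t *\<^sub>R y))\<^sup>2)) has_real_derivative
      core_profile_deriv q ((norm (x + t *\<^sub>R y))\<^sup>2) * (2 * ((x + t *\<^sub>R y) \<bullet> y))) (at t within A)"
    by (rule DERIV_chain2[OF has_real_derivative_core_profile[OF assms] 1])
  have 3: "((\<lambda>t. perp (x + t *\<^sub>R y)) has_vector_derivative perp y) (at t within A)"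
    unfolding perp_add perp_scaleR by (auto intro!: derivative_eq_intros)
  show ?thesis
    unfolding core_velocity_def core_gradient_def
    by (rule has_vector_derivative_eq_rhs, rule has_vector_derivative_scaleR[OF 2 3]) (simp add: mult_ac)
qed

text \<open>
  Averaging over a rotation by a right angle removes the dependence on the direction of \<open>z\<close>.
\<close>

lemma norm_core_gradient_square:
  "(norm (core_gradient q z y))\<^sup>2 + (norm (core_gradient q (perp z) y))\<^sup>2 =
     2 * (norm y)\<^sup>2 * ((core_profile q ((norm z)\<^sup>2))\<^sup>2
       + 2 * core_profile q ((norm z)\<^sup>2) * core_profile_deriv q ((norm z)\<^sup>2) * (norm z)\<^sup>2
       + 2 * (core_profile_deriv q ((norm z)\<^sup>2) * (norm z)\<^sup>2)\<^sup>2)"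
proof -
  \<comment> \<open>Rotation preserves inner products, so the cross term is again
    \<open>z \<bullet> y\<close>: the square depends on \<open>y\<close> only through its norm and
    this inner product.\<close>
  have *: "(norm (core_gradient q z y))\<^sup>2 = (core_profile q ((norm z)\<^sup>2))\<^sup>2 * (norm y)\<^sup>2
      + 4 * (core_profile q ((norm z)\<^sup>2) * core_profile_deriv q ((norm z)\<^sup>2)
        + (core_profile_deriv q ((norm z)\<^sup>2))\<^sup>2 * (norm z)\<^sup>2) * (z \<bullet> y)\<^sup>2" for z
    unfolding core_gradient_def power2_norm_eq_inner
    by (simp add: inner_add_left inner_add_right inner_commute[of y z])
       (simp add: power2_eq_square algebra_simps)
  have "(norm (core_gradient q z y))\<^sup>2 + (norm (core_gradient q (perp z) y))\<^sup>2 =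
      2 * (core_profile q ((norm z)\<^sup>2))\<^sup>2 * (norm y)\<^sup>2
      + 4 * (core_profile q ((norm z)\<^sup>2) * core_profile_deriv q ((norm z)\<^sup>2)
        + (core_profile_deriv q ((norm z)\<^sup>2))\<^sup>2 * (norm z)\<^sup>2) * ((z \<bullet> y)\<^sup>2 + (perp z \<bullet> y)\<^sup>2)"
    unfolding * by (simp add: algebra_simps)
  then show ?thesis
    unfolding inner_square_add_perp by (simp add: power_mult_distrib algebra_simps)
qed

text \<open>Rotation invariance turns twice the integral into the integral of the sum at
  \<open>z\<close> and \<open>perp z\<close>, which is radial in \<open>z\<close>. In the variable s
  the core contributes 5/(3q) and the exterior 1/q, together 8/(3q); the factor 2 cancels against
  that of \<open>norm_core_gradient_square\<close>.\<close>

lemma nn_integral_core_gradient: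
  assumes q: "0 < q"
  shows "(\<integral>\<^sup>+z. ennreal ((norm (core_gradient q z y))\<^sup>2) \<partial>lborel) \<le> ennreal (8 * pi / (3 * q) * (norm y)\<^sup>2)"
    (is "?I \<le> _")
proof -
  have [measurable]: "(\<lambda>z. core_gradient q z y) \<in> borel_measurable borel"
    by (intro borel_measurable_continuous_onI continuous_on_core_gradient q continuous_intros)
  \<comment> \<open>\<open>a\<close> and \<open>b\<close> are the bracket of
    \<open>norm_core_gradient_square\<close> inside and outside the core.\<close>
  define a where "a s = (4 * q\<^sup>2 - 8 * q * s + 5 * s\<^sup>2) / q ^ 4" for s
  define b where "b s = 1 / s\<^sup>2" for s :: real
  have [measurable]: "a \<in> borel_measurable borel" "b \<in> borel_measurable borel"
    unfolding a_def b_def by measurable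
  have a0: "0 \<le> a s" for s
  proof -
    have "4 * q\<^sup>2 - 8 * q * s + 5 * s\<^sup>2 = (2 * q - 2 * s)\<^sup>2 + s\<^sup>2"
      by (simp add: power2_eq_square algebra_simps)
    then show ?thesis unfolding a_def by (metis sum_power2_ge_zero zero_le_divide_iff zero_le_even_power even_numeral)
  qed
  \<comment> \<open>Closed intervals suit the fundamental theorem of calculus. They overlap only at
    s = q, a null set, where \<open>G\<close> is an upper bound.\<close>
  define G where "G s = ennreal (a s) * indicator {0..q} s + ennreal (b s) * indicator {q..} s" for s
  have [measurable]: "G \<in> borel_measurable borel" unfolding G_def by measurable
  have pt: "ennreal ((norm (core_gradient q z y))\<^sup>2) + ennreal ((norm (core_gradient q (perp z) y))\<^sup>2)
      \<le> ennreal (2 * (norm y)\<^sup>2) * G ((norm z)\<^sup>2)" for z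
  proof -
    define s where "s = (norm z)\<^sup>2"
    have s: "0 \<le> s" by (simp add: s_def)
    have "(core_profile q s)\<^sup>2 + 2 * core_profile q s * core_profile_deriv q s * s
       + 2 * (core_profile_deriv q s * s)\<^sup>2 = (if s \<le> q then a s else b s)"
    proof (cases "s \<le> q")
      case True
      then show ?thesis using q
        by (simp add: core_profile_def core_profile_deriv_def a_def max_def field_simps)
           (simp add: power2_eq_square algebra_simps power4_eq_xxxx)
    next
      case False
      then show ?thesis using q
        by (simp add: core_profile_def core_profile_deriv_def b_def max_def field_simps)
    qed
    then have "ennreal ((norm (core_gradient q z y))\<^sup>2) + ennreal ((norm (core_gradient q (perp z) y))\<^sup>2)
        = ennreal (2 * (norm y)\<^sup>2) * ennreal (if s \<le> q then a s else b s)"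
      unfolding ennreal_plus[OF zero_le_power2 zero_le_power2, symmetric] norm_core_gradient_square s_def
      by (subst ennreal_mult[symmetric]) (auto simp: a0 b_def)
    also have "\<dots> \<le> ennreal (2 * (norm y)\<^sup>2) * G s"
      using s by (intro mult_left_mono) (auto simp: G_def)
    finally show ?thesis unfolding s_def .
  qed
  have "(\<integral>\<^sup>+s\<in>{0..}. G s \<partial>lborel) \<le> (\<integral>\<^sup>+s. G s \<partial>lborel)"
    by (intro nn_integral_mono) (auto split: split_indicator)
  also have "(\<integral>\<^sup>+s. G s \<partial>lborel) = (\<integral>\<^sup>+s. ennreal (a s) * indicator {0..q} s \<partial>lborel)
      + (\<integral>\<^sup>+s. ennreal (b s) * indicator {q..} s \<partial>lborel)"
    unfolding G_def by (subst nn_integral_add) auto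
  also have "(\<integral>\<^sup>+s. ennreal (a s) * indicator {0..q} s \<partial>lborel) = ennreal (5 / (3 * q))"
  proof -
    define F where "F s = (4 * q\<^sup>2 * s - 4 * q * s\<^sup>2 + 5 / 3 * s ^ 3) / q ^ 4" for s
    have "((\<lambda>s. 4 * q\<^sup>2 * s - 4 * q * s\<^sup>2 + 5 / 3 * s ^ 3) has_real_derivative
        4 * q\<^sup>2 - 8 * q * s + 5 * s\<^sup>2) (at s)" for s
      by (auto intro!: derivative_eq_intros)
    from DERIV_cdivide[OF this] have "(F has_real_derivative a s) (at s)" for s
      unfolding F_def[abs_def] a_def .
    then have "(\<integral>\<^sup>+s. ennreal (a s) * indicator {0..q} s \<partial>lborel) = ennreal (F q - F 0)"
      using q a0 by (intro nn_integral_FTC_Icc) auto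
    also have "\<dots> = ennreal (5 / (3 * q))"
      using q by (intro arg_cong[where f=ennreal])
        (simp add: F_def field_simps power2_eq_square power3_eq_cube power4_eq_xxxx)
    finally show ?thesis .
  qed
  also have "(\<integral>\<^sup>+s. ennreal (b s) * indicator {q..} s \<partial>lborel) = ennreal (1 / q)"
  proof -
    have "((\<lambda>s. - 1 / s) \<longlongrightarrow> 0) (at_top :: real filter)"
      by (intro tendsto_divide_0[OF tendsto_const] filterlim_at_top_imp_at_infinity filterlim_ident)
    then have "(\<integral>\<^sup>+s. ennreal (b s) * indicator {q..} s \<partial>lborel) = ennreal (0 - (\<lambda>s. - 1 / s) q)"
      using q by (intro nn_integral_FTC_atLeast)
        (auto intro!: derivative_eq_intros simp: b_def power2_eq_square)
    then show ?thesis using q by simp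
  qed
  also have "ennreal (5 / (3 * q)) + ennreal (1 / q) = ennreal (8 / (3 * q))"
    using q by (simp flip: ennreal_plus add: field_simps)
  finally have G: "(\<integral>\<^sup>+s\<in>{0..}. G s \<partial>lborel) \<le> ennreal (8 / (3 * q))" .
  have "2 * ?I = ?I + (\<integral>\<^sup>+z. ennreal ((norm (core_gradient q (perp z) y))\<^sup>2) \<partial>lborel)"
    by (subst nn_integral_perp[of "\<lambda>z. ennreal ((norm (core_gradient q z y))\<^sup>2)"]) (auto simp: mult_2)
  also have "\<dots> = (\<integral>\<^sup>+z. ennreal ((norm (core_gradient q z y))\<^sup>2) + ennreal ((norm (core_gradient q (perp z) y))\<^sup>2) \<partial>lborel)"
    by (subst nn_integral_add) auto
  also have "\<dots> \<le> (\<integral>\<^sup>+z. ennreal (2 * (norm y)\<^sup>2) * G ((norm z)\<^sup>2) \<partial>(lborel :: (real^2) measure))"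
    by (intro nn_integral_mono pt)
  also have "\<dots> = ennreal (2 * (norm y)\<^sup>2) * (ennreal pi * (\<integral>\<^sup>+s\<in>{0..}. G s \<partial>lborel))"
    by (subst nn_integral_cmult) (auto simp: nn_integral_norm_square)
  also have "\<dots> \<le> ennreal (2 * (norm y)\<^sup>2) * (ennreal pi * ennreal (8 / (3 * q)))"
    by (intro mult_left_mono G) auto
  also have "\<dots> = 2 * ennreal (8 * pi / (3 * q) * (norm y)\<^sup>2)"
    using q by (simp flip: ennreal_mult ennreal_numeral add: field_simps)
  finally show ?thesis by (subst (asm) ennreal_mult_le_mult_iff) auto
qed

section \<open>Boundedness and translation differences of the core velocity\<close>

lemma borel_measurable_core_profile [measurable]:
  "core_profile q \<in> borel_measurable borel" "core_profile_deriv q \<in> borel_measurable borel"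
  unfolding core_profile_def core_profile_deriv_def by measurable

lemma borel_measurable_core_velocity [measurable]: "core_velocity q \<in> borel_measurable borel"
  unfolding core_velocity_def by measurable

lemma borel_measurable_core_gradient [measurable (raw)]:
  assumes [measurable]: "f \<in> borel_measurable M" "g \<in> borel_measurable M"
  shows "(\<lambda>x. core_gradient q (f x) (g x)) \<in> borel_measurable M"
  unfolding core_gradient_def by measurable

text \<open>A crude bound, used only to make the convolution of \<open>core_velocity q\<close> with
  an integrable vorticity converge at every point.\<close>

lemma norm_core_velocity_le:
  assumes "0 < q"
  shows "norm (core_velocity q z) \<le> 2 / sqrt q"
proof (cases "(norm z)\<^sup>2 \<le> q")
  case True
  have "norm (core_velocity q z) = (2 * q - (norm z)\<^sup>2) / q\<^sup>2 * norm z"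
    using True assms by (simp add: core_velocity_def core_profile_def)
  also have "\<dots> \<le> (2 * q) / q\<^sup>2 * sqrt q"
    using True assms by (intro mult_mono divide_right_mono) (auto intro: real_le_rsqrt)
  also have "\<dots> = 2 / sqrt q"
    using assms by (simp add: field_simps power2_eq_square)
  finally show ?thesis .
next
  case False
  then have "sqrt q \<le> norm z" using assms by (simp add: real_le_lsqrt)
  moreover have "norm (core_velocity q z) = 1 / norm z"
    using False by (simp add: core_velocity_def core_profile_def power2_eq_square)
  moreover have "1 / norm z \<le> 1 / sqrt q"
    using calculation(1) assms by (intro divide_left_mono mult_pos_pos) (auto intro: less_le_trans[of 0 "sqrt q"])
  moreover have "1 / sqrt q \<le> 2 / sqrt q"
    using assms by (simp add: divide_right_mono)
  ultimately show ?thesis by linarith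
qed

text \<open>The difference is the integral of the gradient along the segment from \<open>x\<close>
  to \<open>x - y\<close>. Cauchy-Schwarz over the unit interval costs no constant, and after
  Tonelli translation invariance removes the shift along the segment.\<close>

lemma nn_integral_core_velocity_diff:
  assumes q: "0 < q"
  shows "(\<integral>\<^sup>+x. ennreal ((norm (core_velocity q (x - y) - core_velocity q x))\<^sup>2) \<partial>lborel)
    \<le> ennreal (8 * pi / (3 * q) * (norm y)\<^sup>2)"
proof -
  define g where "g x t = core_gradient q (x + t *\<^sub>R (- y)) (- y)" for x t
  have [measurable]: "(\<lambda>(x, t). g x t) \<in> borel_measurable (borel \<Otimes>\<^sub>M borel)"
    unfolding g_def by measurable
  have [measurable]: "g x \<in> borel_measurable borel" "(\<lambda>x. g x t) \<in> borel_measurable borel" for x t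
    unfolding g_def by measurable
  let ?I = "indicator {0..1::real}"
  have pt: "ennreal ((norm (core_velocity q (x - y) - core_velocity q x))\<^sup>2)
      \<le> (\<integral>\<^sup>+t. ?I t * ennreal ((norm (g x t))\<^sup>2) \<partial>lborel)" for x
  proof -
    have "has_bochner_integral lborel (\<lambda>t. ?I t *\<^sub>R g x t)
        (core_velocity q (x + 1 *\<^sub>R (- y)) - core_velocity q (x + 0 *\<^sub>R (- y)))"
      unfolding g_def
      by (intro has_bochner_integral_FTC_Icc has_vector_derivative_core_velocity
          continuous_on_core_gradient continuous_intros q) simp
    then have "ennreal (norm (core_velocity q (x - y) - core_velocity q x))
        \<le> (\<integral>\<^sup>+t. ennreal (norm (?I t *\<^sub>R g x t)) \<partial>lborel)"
      using has_bochner_integral_norm_bound by fastforce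
    \<comment> \<open>The indicator is idempotent; its second copy serves as the other factor in
      Cauchy-Schwarz, where it contributes the length 1.\<close>
    also have "\<dots> = (\<integral>\<^sup>+t. ?I t * ennreal (norm (?I t *\<^sub>R g x t)) \<partial>lborel)"
      by (intro nn_integral_cong) (auto split: split_indicator)
    finally have "(ennreal (norm (core_velocity q (x - y) - core_velocity q x)))\<^sup>2 \<le> \<dots>\<^sup>2"
      by (intro power_mono) auto
    also have "\<dots> \<le> (\<integral>\<^sup>+t. (?I t)\<^sup>2 \<partial>lborel) * (\<integral>\<^sup>+t. (ennreal (norm (?I t *\<^sub>R g x t)))\<^sup>2 \<partial>lborel)"
      by (intro Cauchy_Schwarz_nn_integral) measurable
    also have "(\<integral>\<^sup>+t. (?I t)\<^sup>2 \<partial>lborel) = (\<integral>\<^sup>+t. ?I t \<partial>lborel)"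
      by (intro nn_integral_cong) (auto split: split_indicator)
    also have "\<dots> = 1" by simp
    also have "(\<integral>\<^sup>+t. (ennreal (norm (?I t *\<^sub>R g x t)))\<^sup>2 \<partial>lborel) = (\<integral>\<^sup>+t. ?I t * ennreal ((norm (g x t))\<^sup>2) \<partial>lborel)"
      by (intro nn_integral_cong) (auto split: split_indicator simp: ennreal_power)
    finally show ?thesis by (simp add: ennreal_power)
  qed
  have "(\<integral>\<^sup>+x. ennreal ((norm (core_velocity q (x - y) - core_velocity q x))\<^sup>2) \<partial>lborel)
      \<le> (\<integral>\<^sup>+x. \<integral>\<^sup>+t. ?I t * ennreal ((norm (g x t))\<^sup>2) \<partial>lborel \<partial>lborel)"
    by (intro nn_integral_mono pt)
  also have "\<dots> = (\<integral>\<^sup>+t. \<integral>\<^sup>+x. ?I t * ennreal ((norm (g x t))\<^sup>2) \<partial>lborel \<partial>lborel)"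
    by (rule lborel_pair.Fubini'[symmetric]) measurable
  also have "\<dots> \<le> (\<integral>\<^sup>+t. ?I t * ennreal (8 * pi / (3 * q) * (norm y)\<^sup>2) \<partial>lborel)"
  proof (intro nn_integral_mono)
    fix t :: real
    have "(\<integral>\<^sup>+x. ennreal ((norm (g x t))\<^sup>2) \<partial>lborel) =
        (\<integral>\<^sup>+x. ennreal ((norm (core_gradient q (x - t *\<^sub>R y) (- y)))\<^sup>2) \<partial>lborel)"
      by (simp add: g_def)
    also have "\<dots> = (\<integral>\<^sup>+x. ennreal ((norm (core_gradient q x (- y)))\<^sup>2) \<partial>lborel)"
      by (rule nn_integral_lborel_translate) measurable
    also have "\<dots> \<le> ennreal (8 * pi / (3 * q) * (norm y)\<^sup>2)"
      using nn_integral_core_gradient[OF q, of "- y"] by simp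
    finally show "(\<integral>\<^sup>+x. ?I t * ennreal ((norm (g x t))\<^sup>2) \<partial>lborel)
        \<le> ?I t * ennreal (8 * pi / (3 * q) * (norm y)\<^sup>2)"
      by (subst nn_integral_cmult) (auto intro: mult_left_mono)
  qed
  also have "\<dots> = ennreal (8 * pi / (3 * q) * (norm y)\<^sup>2)"
    by (subst nn_integral_multc) auto
  finally show ?thesis .
qed

section \<open>The singular part of the kernel\<close>

text \<open>The factor 1/(2 * pi) is left out, as in \<open>core_velocity\<close>, and restored only
  in the theorem.\<close>

definition biot_savart_kernel :: "real ^ 2 \<Rightarrow> real ^ 2" where
  "biot_savart_kernel z = (1 / (norm z)\<^sup>2) *\<^sub>R perp z"

lemma borel_measurable_biot_savart_kernel [measurable]: "biot_savart_kernel \<in> borel_measurable borel"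
  unfolding biot_savart_kernel_def by measurable

text \<open>Outside the core the two fields coincide. Inside, their difference has length
  \<open>f s\<close> with s = |z|^2, whose singularity s^(-1/2) is integrable; the constant is 16/15
  = 2 - 4/3 + 2/5.\<close>

lemma nn_integral_kernel_minus_core:
  assumes q: "0 < q"
  shows "(\<integral>\<^sup>+z. ennreal (norm (biot_savart_kernel z - core_velocity q z)) \<partial>lborel) \<le> ennreal (16 / 15 * pi * sqrt q)"
proof -
  define f where "f s = sqrt s * (q - s)\<^sup>2 / (s * q\<^sup>2)" for s
  have [measurable]: "f \<in> borel_measurable borel" unfolding f_def by measurable
  \<comment> \<open>Leaving out s = 0 is harmless: both fields vanish at the origin, since the
    kernel there is a multiple of \<open>perp 0\<close>.\<close>
  define G where "G s = ennreal (f s) * indicator {0<..<q} s" for s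
  have [measurable]: "G \<in> borel_measurable borel" unfolding G_def by measurable
  have pt: "ennreal (norm (biot_savart_kernel z - core_velocity q z)) \<le> G ((norm z)\<^sup>2)" for z
  proof -
    define s where "s = (norm z)\<^sup>2"
    have "norm (biot_savart_kernel z - core_velocity q z) = \<bar>1 / s - core_profile q s\<bar> * sqrt s"
      by (simp add: biot_savart_kernel_def core_velocity_def s_def flip: scaleR_diff_left)
    also have "ennreal \<dots> = G s"
    proof (cases "s < q \<and> s \<noteq> 0")
      case True
      then have "0 < s" by (auto simp: s_def)
      with True q have "1 / s - core_profile q s = (q - s)\<^sup>2 / (s * q\<^sup>2)"
        by (simp add: core_profile_def divide_simps) (simp add: power2_eq_square algebra_simps)
      then show ?thesis using True \<open>0 < s\<close> by (simp add: G_def f_def)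
    next
      case False
      then show ?thesis using q
        by (auto simp: G_def core_profile_def field_simps power2_eq_square)
    qed
    finally show ?thesis by (simp add: s_def)
  qed
  \<comment> \<open>Termwise antiderivative of \<open>f s\<close>, which expands to s^(-1/2) - 2
    s^(1/2)/q + s^(3/2)/q^2.\<close>
  define F where "F s = 2 * sqrt s - 4 / 3 * (s * sqrt s) / q + 2 / 5 * (s\<^sup>2 * sqrt s) / q\<^sup>2" for s
  have D: "(F has_real_derivative f s) (at s)" if "0 < s" for s
  proof -
    define r where "r = sqrt s"
    have r: "s = r\<^sup>2" "0 < r" using that by (simp_all add: r_def)
    have sq: "(sqrt has_real_derivative inverse (sqrt s) / 2) (at s)"
      using DERIV_real_sqrt[OF that] by simp
    have "((\<lambda>s. 2 * sqrt s) has_real_derivative inverse (sqrt s)) (at s)"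
      using DERIV_cmult[OF sq, of 2] by simp
    moreover have "((\<lambda>s. 4 / 3 * (s * sqrt s) / q) has_real_derivative
        4 / 3 * (sqrt s + s * (inverse (sqrt s) / 2)) / q) (at s)"
      by (rule DERIV_cong, rule DERIV_cdivide, rule DERIV_cmult, rule DERIV_mult[OF DERIV_ident sq]) simp
    moreover have "((\<lambda>s. 2 / 5 * (s\<^sup>2 * sqrt s) / q\<^sup>2) has_real_derivative
        2 / 5 * (2 * s * sqrt s + s\<^sup>2 * (inverse (sqrt s) / 2)) / q\<^sup>2) (at s)"
      by (rule DERIV_cong, rule DERIV_cdivide, rule DERIV_cmult, rule DERIV_mult[OF DERIV_pow[of 2] sq]) simp
    ultimately have "(F has_real_derivative inverse (sqrt s) - 4 / 3 * (sqrt s + s * (inverse (sqrt s) / 2)) / q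
        + 2 / 5 * (2 * s * sqrt s + s\<^sup>2 * (inverse (sqrt s) / 2)) / q\<^sup>2) (at s)"
      unfolding F_def[abs_def] by (intro DERIV_add DERIV_diff)
    moreover have "inverse (sqrt s) - 4 / 3 * (sqrt s + s * (inverse (sqrt s) / 2)) / q
        + 2 / 5 * (2 * s * sqrt s + s\<^sup>2 * (inverse (sqrt s) / 2)) / q\<^sup>2 = f s"
    proof -
      have "sqrt s = r" using r by simp
      have "inverse r - 4 / 3 * (r + r\<^sup>2 * (inverse r / 2)) / q
        + 2 / 5 * (2 * r\<^sup>2 * r + (r\<^sup>2)\<^sup>2 * (inverse r / 2)) / q\<^sup>2 = 1 / r - 2 * r / q + r ^ 3 / q\<^sup>2"
        using r q by (simp add: field_simps power2_eq_square power3_eq_cube)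
      also have "\<dots> = r * (q - r\<^sup>2)\<^sup>2 / (r\<^sup>2 * q\<^sup>2)"
        using r q by (simp add: divide_simps) (simp add: power2_eq_square power3_eq_cube algebra_simps)
      finally show ?thesis unfolding f_def \<open>sqrt s = r\<close> unfolding r(1) .
    qed
    ultimately show ?thesis by simp
  qed
  have f0: "0 \<le> f s" if "0 < s" for s using that by (simp add: f_def)
  have cont: "isCont F s" for s unfolding F_def by (intro continuous_intros) (use q in auto)
  \<comment> \<open>\<open>f\<close> is unbounded near 0, so the fundamental theorem is applied on
    the open interval, with limits of \<open>F\<close> at its ends.\<close>
  have lim: "((F \<circ> real_of_ereal) \<longlongrightarrow> F 0) (at_right (ereal 0))" "((F \<circ> real_of_ereal) \<longlongrightarrow> F q) (at_left (ereal q))"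
    using cont by (auto simp: ereal_tendsto_simps isCont_def filterlim_at_split)
  have fc: "isCont f s" if "0 < s" for s
    unfolding f_def using that q by (intro continuous_intros) auto
  have "set_integrable lborel (einterval (ereal 0) (ereal q)) f"
    by (rule interval_integral_FTC_nonneg(1)[OF _ _ _ _ lim]) (use q D fc f0 in auto)
  moreover have "(LBINT x=ereal 0..ereal q. f x) = F q - F 0"
    by (rule interval_integral_FTC_nonneg(2)[OF _ _ _ _ lim]) (use q D fc f0 in auto)
  ultimately have "set_integrable lborel {0<..<q} f" "(LBINT x:{0<..<q}. f x) = F q - F 0"
    using q by (simp_all add: interval_lebesgue_integral_def)
  then have "(\<integral>\<^sup>+s. ennreal (indicator {0<..<q} s *\<^sub>R f s) \<partial>lborel) = ennreal (F q - F 0)"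
    unfolding set_integrable_def set_lebesgue_integral_def
    by (subst nn_integral_eq_integral) (auto split: split_indicator intro!: f0)
  also have "(\<integral>\<^sup>+s. ennreal (indicator {0<..<q} s *\<^sub>R f s) \<partial>lborel) = (\<integral>\<^sup>+s\<in>{0..}. G s \<partial>lborel)"
    by (intro nn_integral_cong) (auto simp: G_def split: split_indicator)
  also have "F q - F 0 = 16 / 15 * sqrt q"
    using q by (simp add: F_def field_simps power2_eq_square)
  finally have int: "(\<integral>\<^sup>+s\<in>{0..}. G s \<partial>lborel) = ennreal (16 / 15 * sqrt q)" .
  have "(\<integral>\<^sup>+z. ennreal (norm (biot_savart_kernel z - core_velocity q z)) \<partial>lborel)
      \<le> (\<integral>\<^sup>+z. G ((norm (z :: real^2))\<^sup>2) \<partial>lborel)"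
    by (intro nn_integral_mono pt)
  also have "\<dots> = ennreal (16 / 15 * pi * sqrt q)"
    using q by (simp add: nn_integral_norm_square int field_simps flip: ennreal_mult)
  finally show ?thesis .
qed

section \<open>Young and Minkowski type inequalities\<close>

lemma nn_integral_lborel_reflect:
  fixes f :: "'a::euclidean_space \<Rightarrow> ennreal"
  assumes [measurable]: "f \<in> borel_measurable borel"
  shows "(\<integral>\<^sup>+x. f (a - x) \<partial>lborel) = (\<integral>\<^sup>+x. f x \<partial>lborel)"
  by (subst (2) lborel_affine[of "-1" a]) (simp_all add: nn_integral_density nn_integral_distr)

text \<open>Young's inequality for L^1 * L^2: write the kernel as the product of two square roots,
  give one to each factor of Cauchy-Schwarz, and apply Tonelli.\<close>

lemma nn_integral_convolution_square:
  fixes k :: "'a::euclidean_space \<Rightarrow> real" and f :: "'a \<Rightarrow> ennreal"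
  assumes [measurable]: "k \<in> borel_measurable borel" "f \<in> borel_measurable borel"
    and k: "\<And>x. 0 \<le> k x"
  shows "(\<integral>\<^sup>+x. (\<integral>\<^sup>+y. ennreal (k (x - y)) * f y \<partial>lborel)\<^sup>2 \<partial>lborel)
    \<le> (\<integral>\<^sup>+x. ennreal (k x) \<partial>lborel)\<^sup>2 * (\<integral>\<^sup>+y. (f y)\<^sup>2 \<partial>lborel)"
proof -
  let ?K = "\<integral>\<^sup>+x. ennreal (k x) \<partial>lborel"
  have sq: "ennreal (sqrt (k z)) * ennreal (sqrt (k z)) = ennreal (k z)" for z
    using k by (simp flip: ennreal_mult)
  have "(\<integral>\<^sup>+y. ennreal (k (x - y)) * f y \<partial>lborel)\<^sup>2 \<le> ?K * (\<integral>\<^sup>+y. ennreal (k (x - y)) * (f y)\<^sup>2 \<partial>lborel)" for x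
  proof -
    have "(\<integral>\<^sup>+y. ennreal (k (x - y)) * f y \<partial>lborel)\<^sup>2 =
        (\<integral>\<^sup>+y. ennreal (sqrt (k (x - y))) * (ennreal (sqrt (k (x - y))) * f y) \<partial>lborel)\<^sup>2"
      by (simp flip: mult.assoc add: sq)
    also have "\<dots> \<le> (\<integral>\<^sup>+y. (ennreal (sqrt (k (x - y))))\<^sup>2 \<partial>lborel) * (\<integral>\<^sup>+y. (ennreal (sqrt (k (x - y))) * f y)\<^sup>2 \<partial>lborel)"
      by (intro Cauchy_Schwarz_nn_integral) measurable
    also have "\<dots> = (\<integral>\<^sup>+y. ennreal (k (x - y)) \<partial>lborel) * (\<integral>\<^sup>+y. ennreal (k (x - y)) * (f y)\<^sup>2 \<partial>lborel)"
      by (simp add: power_mult_distrib) (simp add: power2_eq_square sq)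
    also have "(\<integral>\<^sup>+y. ennreal (k (x - y)) \<partial>lborel) = ?K"
      by (rule nn_integral_lborel_reflect) measurable
    finally show ?thesis .
  qed
  then have "(\<integral>\<^sup>+x. (\<integral>\<^sup>+y. ennreal (k (x - y)) * f y \<partial>lborel)\<^sup>2 \<partial>lborel)
      \<le> (\<integral>\<^sup>+x. ?K * (\<integral>\<^sup>+y. ennreal (k (x - y)) * (f y)\<^sup>2 \<partial>lborel) \<partial>lborel)"
    by (intro nn_integral_mono)
  also have "\<dots> = ?K * (\<integral>\<^sup>+x. \<integral>\<^sup>+y. ennreal (k (x - y)) * (f y)\<^sup>2 \<partial>lborel \<partial>lborel)"
    by (rule nn_integral_cmult) measurable
  also have "(\<integral>\<^sup>+x. \<integral>\<^sup>+y. ennreal (k (x - y)) * (f y)\<^sup>2 \<partial>lborel \<partial>lborel)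
      = (\<integral>\<^sup>+y. \<integral>\<^sup>+x. ennreal (k (x - y)) * (f y)\<^sup>2 \<partial>lborel \<partial>lborel)"
    by (rule lborel_pair.Fubini'[symmetric]) measurable
  also have "\<dots> = (\<integral>\<^sup>+y. ?K * (f y)\<^sup>2 \<partial>lborel)"
    by (subst nn_integral_multc) (auto simp: nn_integral_lborel_translate[of "\<lambda>x. ennreal (k x)"])
  also have "\<dots> = ?K * (\<integral>\<^sup>+y. (f y)\<^sup>2 \<partial>lborel)"
    by (rule nn_integral_cmult) measurable
  finally show ?thesis by (simp add: power2_eq_square mult.assoc)
qed

text \<open>Minkowski's integral inequality in squared form. Cauchy-Schwarz is weighted by |y|: the
  factors are sqrt(|y| f) and d sqrt(f/|y|), so the hypothesis c |y|^2 on the square of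
  \<open>d\<close> turns the second factor into another first moment.\<close>

lemma nn_integral_superposition_square:
  fixes d :: "'a::euclidean_space \<Rightarrow> 'b::euclidean_space \<Rightarrow> real" and f :: "'b \<Rightarrow> real"
  assumes [measurable]: "(\<lambda>(x, y). d x y) \<in> borel_measurable (borel \<Otimes>\<^sub>M borel)" "f \<in> borel_measurable borel"
    and d0: "\<And>x y. 0 \<le> d x y" and f0: "\<And>y. 0 \<le> f y"
    and d: "\<And>y. (\<integral>\<^sup>+x. ennreal ((d x y)\<^sup>2) \<partial>lborel) \<le> ennreal (c * (norm y)\<^sup>2)" and c: "0 \<le> c"
  shows "(\<integral>\<^sup>+x. (\<integral>\<^sup>+y. ennreal (d x y * f y) \<partial>lborel)\<^sup>2 \<partial>lborel)
    \<le> ennreal c * (\<integral>\<^sup>+y. ennreal (norm y * f y) \<partial>lborel)\<^sup>2"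
proof -
  let ?M = "\<integral>\<^sup>+y. ennreal (norm y * f y) \<partial>lborel"
  have [measurable]: "(\<lambda>y. d x y) \<in> borel_measurable borel" for x by measurable
  have [measurable]: "(\<lambda>x. d x y) \<in> borel_measurable borel" for y by measurable
  have "(\<integral>\<^sup>+x. \<integral>\<^sup>+y. ennreal ((d x y)\<^sup>2) * ennreal (f y / norm y) \<partial>lborel \<partial>lborel)
      = (\<integral>\<^sup>+y. \<integral>\<^sup>+x. ennreal ((d x y)\<^sup>2) * ennreal (f y / norm y) \<partial>lborel \<partial>lborel)"
    by (rule lborel_pair.Fubini'[symmetric]) measurable
  also have "\<dots> \<le> (\<integral>\<^sup>+y. ennreal c * ennreal (norm y * f y) \<partial>lborel)"
  proof (intro nn_integral_mono)
    fix y
    have "(\<integral>\<^sup>+x. ennreal ((d x y)\<^sup>2) * ennreal (f y / norm y) \<partial>lborel)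
        = (\<integral>\<^sup>+x. ennreal ((d x y)\<^sup>2) \<partial>lborel) * ennreal (f y / norm y)"
      by (rule nn_integral_multc) measurable
    also have "\<dots> \<le> ennreal (c * (norm y)\<^sup>2) * ennreal (f y / norm y)"
      by (intro mult_right_mono d) auto
    also have "\<dots> = ennreal c * ennreal (norm y * f y)"
      using c f0 by (cases "y = 0") (simp_all add: power2_eq_square mult_ac flip: ennreal_mult)
    finally show "(\<integral>\<^sup>+x. ennreal ((d x y)\<^sup>2) * ennreal (f y / norm y) \<partial>lborel) \<le> ennreal c * ennreal (norm y * f y)" .
  qed
  also have "\<dots> = ennreal c * ?M"
    by (rule nn_integral_cmult) measurable
  finally have swap: "(\<integral>\<^sup>+x. \<integral>\<^sup>+y. ennreal ((d x y)\<^sup>2) * ennreal (f y / norm y) \<partial>lborel \<partial>lborel) \<le> ennreal c * ?M" .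
  have pt: "(\<integral>\<^sup>+y. ennreal (d x y * f y) \<partial>lborel)\<^sup>2 \<le> ?M * (\<integral>\<^sup>+y. ennreal ((d x y)\<^sup>2) * ennreal (f y / norm y) \<partial>lborel)" for x
  proof -
    \<comment> \<open>The factorization can fail at y = 0, where the right-hand side is 0; a single
      point is negligible.\<close>
    have "AE y in lborel. ennreal (d x y * f y) =
        ennreal (sqrt (norm y * f y)) * ennreal (d x y * sqrt (f y / norm y))"
      using AE_lborel_singleton[of 0]
    proof eventually_elim
      case (elim y)
      have "sqrt (norm y * f y) * (d x y * sqrt (f y / norm y)) = d x y * sqrt ((norm y * f y) * (f y / norm y))"
        unfolding real_sqrt_mult by (simp add: mult_ac)
      also have "(norm y * f y) * (f y / norm y) = (f y)\<^sup>2"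
        using elim by (simp add: power2_eq_square)
      finally have "sqrt (norm y * f y) * (d x y * sqrt (f y / norm y)) = d x y * f y"
        using f0 by simp
      moreover have "0 \<le> sqrt (norm y * f y)" "0 \<le> d x y * sqrt (f y / norm y)"
        using f0 d0 by simp_all
      ultimately show ?case by (metis ennreal_mult)
    qed
    then have "(\<integral>\<^sup>+y. ennreal (d x y * f y) \<partial>lborel)\<^sup>2 =
        (\<integral>\<^sup>+y. ennreal (sqrt (norm y * f y)) * ennreal (d x y * sqrt (f y / norm y)) \<partial>lborel)\<^sup>2"
      by (intro arg_cong[where f="\<lambda>x. x\<^sup>2"] nn_integral_cong_AE)
    also have "\<dots> \<le> (\<integral>\<^sup>+y. (ennreal (sqrt (norm y * f y)))\<^sup>2 \<partial>lborel) * (\<integral>\<^sup>+y. (ennreal (d x y * sqrt (f y / norm y)))\<^sup>2 \<partial>lborel)"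
      by (intro Cauchy_Schwarz_nn_integral) measurable
    also have "\<dots> = ?M * (\<integral>\<^sup>+y. ennreal ((d x y)\<^sup>2) * ennreal (f y / norm y) \<partial>lborel)"
      using f0 d0 by (simp add: ennreal_power power_mult_distrib flip: ennreal_mult)
    finally show ?thesis .
  qed
  have "(\<integral>\<^sup>+x. (\<integral>\<^sup>+y. ennreal (d x y * f y) \<partial>lborel)\<^sup>2 \<partial>lborel)
      \<le> (\<integral>\<^sup>+x. ?M * (\<integral>\<^sup>+y. ennreal ((d x y)\<^sup>2) * ennreal (f y / norm y) \<partial>lborel) \<partial>lborel)"
    by (intro nn_integral_mono pt)
  also have "\<dots> = ?M * (\<integral>\<^sup>+x. \<integral>\<^sup>+y. ennreal ((d x y)\<^sup>2) * ennreal (f y / norm y) \<partial>lborel \<partial>lborel)"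
    by (rule nn_integral_cmult) measurable
  also have "\<dots> \<le> ?M * (ennreal c * ?M)"
    by (intro mult_left_mono swap) simp
  finally show ?thesis
    by (simp add: power2_eq_square mult_ac)
qed

text \<open>Equality holds for a = b. As the final q makes the two bounds nearly equal, hardly
  anything is lost against the triangle inequality.\<close>

lemma ennreal_square_add_le: "(a + b)\<^sup>2 \<le> 2 * a\<^sup>2 + 2 * b\<^sup>2" for a b :: ennreal
proof (cases a; cases b)
  fix r s assume *: "a = ennreal r" "0 \<le> r" "b = ennreal s" "0 \<le> s"
  have "(a + b)\<^sup>2 = ennreal ((r + s)\<^sup>2)"
    using * by (simp add: ennreal_power flip: ennreal_plus)
  also have "\<dots> \<le> ennreal (2 * r\<^sup>2 + 2 * s\<^sup>2)"
    using sum_squares_bound[of r s] by (intro ennreal_leI) (simp add: power2_sum)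
  also have "\<dots> = 2 * a\<^sup>2 + 2 * b\<^sup>2"
    using * by (simp add: ennreal_power ennreal_mult)
  finally show ?thesis .
qed (auto simp: power2_eq_square ennreal_top_mult ennreal_mult_top)

text \<open>In the unit ball |f| is at most 1 + f^2, outside it at most |x| |f|. Integrability of
  the vorticity is what lets a constant multiple of it be subtracted under the integral.\<close>

lemma integrable_of_square_and_moment:
  fixes f :: "'a::euclidean_space \<Rightarrow> real"
  assumes [measurable]: "f \<in> borel_measurable borel"
    and "integrable lborel (\<lambda>x. (f x)\<^sup>2)" "integrable lborel (\<lambda>x. norm x * \<bar>f x\<bar>)"
  shows "integrable lborel f"
proof (rule Bochner_Integration.integrable_bound)
  have "emeasure lborel (cball 0 1 :: 'a set) < \<infinity>"
    by (intro emeasure_bounded_finite) auto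
  then show "integrable lborel (\<lambda>x. indicator (cball 0 1) x + (f x)\<^sup>2 + norm x * \<bar>f x\<bar>)"
    using assms by (intro Bochner_Integration.integrable_add) (auto simp: less_top[symmetric])
  have "\<bar>f x\<bar> \<le> indicator (cball 0 1) x + (f x)\<^sup>2 + norm x * \<bar>f x\<bar>" for x
  proof (cases "norm x \<le> 1")
    case True
    have "2 * \<bar>f x\<bar> \<le> 1 + (f x)\<^sup>2" using sum_squares_bound[of 1 "\<bar>f x\<bar>"] by simp
    moreover have "0 \<le> norm x * \<bar>f x\<bar>" by simp
    moreover have "indicator (cball 0 1) x = (1 :: real)" using True by simp
    ultimately show ?thesis by linarith
  next
    case False
    then have "1 * \<bar>f x\<bar> \<le> norm x * \<bar>f x\<bar>" by (intro mult_right_mono) auto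
    then show ?thesis by (simp add: add_increasing)
  qed
  moreover have "0 \<le> indicator (cball 0 1) x + (f x)\<^sup>2 + norm x * \<bar>f x\<bar>" for x by simp
  ultimately show "AE x in lborel. norm (f x) \<le> norm (indicator (cball 0 1) x + (f x)\<^sup>2 + norm x * \<bar>f x\<bar>)"
    by (simp add: order.trans[OF _ abs_ge_self])
qed simp

section \<open>The energy estimate for an arbitrary core radius\<close>

lemma biot_savart_split_bound:
  fixes \<omega> :: "real ^ 2 \<Rightarrow> real"
  assumes [measurable]: "\<omega> \<in> borel_measurable borel"
    and sq: "integrable lborel (\<lambda>x. (\<omega> x)\<^sup>2)" and mom: "integrable lborel (\<lambda>x. norm x * \<bar>\<omega> x\<bar>)"
    and zero: "(\<integral>x. \<omega> x \<partial>lborel) = 0" and q: "0 < q"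
  shows "AE x in lborel. integrable lborel (\<lambda>y. \<omega> y *\<^sub>R biot_savart_kernel (x - y))"
    and "(\<integral>\<^sup>+x. ennreal ((norm (\<integral>y. \<omega> y *\<^sub>R biot_savart_kernel (x - y) \<partial>lborel))\<^sup>2) \<partial>lborel) \<le>
      ennreal (2 * (16 / 15 * pi)\<^sup>2 * q * (\<integral>x. (\<omega> x)\<^sup>2 \<partial>lborel)
        + 16 * pi / (3 * q) * (\<integral>x. norm x * \<bar>\<omega> x\<bar> \<partial>lborel)\<^sup>2)"
proof -
  define k where "k z = biot_savart_kernel z - core_velocity q z" for z
  define d where "d x y = norm (core_velocity q (x - y) - core_velocity q x)" for x y
  have [measurable]: "k \<in> borel_measurable borel" unfolding k_def by measurable
  have [measurable]: "(\<lambda>(x, y). d x y) \<in> borel_measurable (borel \<Otimes>\<^sub>M borel)" unfolding d_def by measurable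
  \<comment> \<open>\<open>V1\<close> and \<open>V2\<close> are pointwise majorants, possibly
    infinite, of the convolutions with the singular part and with the core velocity.\<close>
  define V1 where "V1 x = (\<integral>\<^sup>+y. ennreal (norm (k (x - y))) * ennreal \<bar>\<omega> y\<bar> \<partial>lborel)" for x
  define V2 where "V2 x = (\<integral>\<^sup>+y. ennreal (d x y * \<bar>\<omega> y\<bar>) \<partial>lborel)" for x
  have [measurable]: "V1 \<in> borel_measurable borel" "V2 \<in> borel_measurable borel"
    unfolding V1_def V2_def by measurable
  let ?A = "\<integral>x. (\<omega> x)\<^sup>2 \<partial>lborel" and ?M = "\<integral>x. norm x * \<bar>\<omega> x\<bar> \<partial>lborel"
  have A0: "0 \<le> ?A" and M0: "0 \<le> ?M" by simp_all
  have V1: "(\<integral>\<^sup>+x. (V1 x)\<^sup>2 \<partial>lborel) \<le> ennreal ((16 / 15 * pi)\<^sup>2 * q * ?A)"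
  proof -
    have "(\<integral>\<^sup>+x. (V1 x)\<^sup>2 \<partial>lborel) \<le> (\<integral>\<^sup>+z. ennreal (norm (k z)) \<partial>lborel)\<^sup>2 * (\<integral>\<^sup>+y. (ennreal \<bar>\<omega> y\<bar>)\<^sup>2 \<partial>lborel)"
      unfolding V1_def by (rule nn_integral_convolution_square) simp_all
    also have "(\<integral>\<^sup>+y. (ennreal \<bar>\<omega> y\<bar>)\<^sup>2 \<partial>lborel) = ennreal ?A"
      by (simp add: ennreal_power nn_integral_eq_integral sq)
    also have "(\<integral>\<^sup>+z. ennreal (norm (k z)) \<partial>lborel)\<^sup>2 * ennreal ?A \<le> (ennreal (16 / 15 * pi * sqrt q))\<^sup>2 * ennreal ?A"
      unfolding k_def by (intro mult_right_mono power_mono nn_integral_kernel_minus_core q) auto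
    also have "\<dots> = ennreal ((16 / 15 * pi * sqrt q)\<^sup>2 * ?A)"
      using q A0 by (subst ennreal_mult) (simp_all add: ennreal_power)
    also have "(16 / 15 * pi * sqrt q)\<^sup>2 * ?A = (16 / 15 * pi)\<^sup>2 * q * ?A"
      unfolding power_mult_distrib using q by simp
    finally show ?thesis .
  qed
  have V2: "(\<integral>\<^sup>+x. (V2 x)\<^sup>2 \<partial>lborel) \<le> ennreal (8 * pi / (3 * q) * ?M\<^sup>2)"
  proof -
    have "(\<integral>\<^sup>+x. (V2 x)\<^sup>2 \<partial>lborel) \<le> ennreal (8 * pi / (3 * q)) * (\<integral>\<^sup>+y. ennreal (norm y * \<bar>\<omega> y\<bar>) \<partial>lborel)\<^sup>2"
      unfolding V2_def
      by (rule nn_integral_superposition_square)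
        (use q nn_integral_core_velocity_diff[OF q] in \<open>simp_all add: d_def\<close>)
    also have "(\<integral>\<^sup>+y. ennreal (norm y * \<bar>\<omega> y\<bar>) \<partial>lborel) = ennreal ?M"
      by (simp add: nn_integral_eq_integral mom)
    also have "ennreal (8 * pi / (3 * q)) * (ennreal ?M)\<^sup>2 = ennreal (8 * pi / (3 * q) * ?M\<^sup>2)"
      using q M0 by (subst ennreal_mult) (simp_all add: ennreal_power)
    finally show ?thesis .
  qed
  have \<omega>_int: "integrable lborel \<omega>"
    by (rule integrable_of_square_and_moment) (use sq mom in auto)
  \<comment> \<open>The square of \<open>V1\<close> has finite integral, hence \<open>V1\<close> is
    finite almost everywhere; this is where the exceptional null set for convergence arises.\<close>
  have "AE x in lborel. (V1 x)\<^sup>2 \<noteq> \<infinity>"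
    by (rule nn_integral_PInf_AE) (use V1 in \<open>auto simp: top_unique\<close>)
  then have AE: "AE x in lborel. integrable lborel (\<lambda>y. \<omega> y *\<^sub>R biot_savart_kernel (x - y)) \<and>
      ennreal (norm (\<integral>y. \<omega> y *\<^sub>R biot_savart_kernel (x - y) \<partial>lborel)) \<le> V1 x + V2 x"
  proof eventually_elim
    case (elim x)
    then have fin: "V1 x < \<infinity>"
      by (auto simp: less_top[symmetric] power2_eq_square ennreal_top_mult)
    have V1_eq: "V1 x = (\<integral>\<^sup>+y. ennreal (norm (\<omega> y *\<^sub>R k (x - y))) \<partial>lborel)"
      unfolding V1_def by (simp add: mult.commute flip: ennreal_mult)
    have 1: "integrable lborel (\<lambda>y. \<omega> y *\<^sub>R k (x - y))"
      by (rule integrableI_bounded) (use fin V1_eq in auto)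
    have 2: "integrable lborel (\<lambda>y. \<omega> y *\<^sub>R core_velocity q (x - y))"
    proof (rule Bochner_Integration.integrable_bound)
      show "integrable lborel (\<lambda>y. \<omega> y * (2 / sqrt q))" using \<omega>_int by simp
      have "\<bar>\<omega> y\<bar> * norm (core_velocity q (x - y)) \<le> \<bar>\<omega> y\<bar> * (2 / sqrt q)" for y
        by (intro mult_left_mono norm_core_velocity_le q) simp
      then show "AE y in lborel. norm (\<omega> y *\<^sub>R core_velocity q (x - y)) \<le> norm (\<omega> y * (2 / sqrt q))"
        using q by (simp add: abs_mult)
    qed simp
    have 3: "integrable lborel (\<lambda>y. \<omega> y *\<^sub>R core_velocity q x)" using \<omega>_int by simp
    have split: "\<omega> y *\<^sub>R biot_savart_kernel (x - y) = \<omega> y *\<^sub>R k (x - y) + \<omega> y *\<^sub>R core_velocity q (x - y)" for y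
      by (simp add: k_def algebra_simps)
    \<comment> \<open>Mean zero enters here: \<open>core_velocity q x\<close> does not depend on
      \<open>y\<close>, so its contribution vanishes and it may be subtracted.\<close>
    have "(\<integral>y. \<omega> y *\<^sub>R core_velocity q x \<partial>lborel) = 0"
      using zero \<omega>_int by (subst integral_scaleR_left) auto
    then have "(\<integral>y. \<omega> y *\<^sub>R core_velocity q (x - y) \<partial>lborel) =
        (\<integral>y. \<omega> y *\<^sub>R core_velocity q (x - y) - \<omega> y *\<^sub>R core_velocity q x \<partial>lborel)"
      using 2 3 by simp
    then have "(\<integral>y. \<omega> y *\<^sub>R biot_savart_kernel (x - y) \<partial>lborel) = (\<integral>y. \<omega> y *\<^sub>R k (x - y) \<partial>lborel) +
        (\<integral>y. \<omega> y *\<^sub>R core_velocity q (x - y) - \<omega> y *\<^sub>R core_velocity q x \<partial>lborel)"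
      unfolding split using 1 2 by simp
    then have "ennreal (norm (\<integral>y. \<omega> y *\<^sub>R biot_savart_kernel (x - y) \<partial>lborel)) \<le>
        ennreal (norm (\<integral>y. \<omega> y *\<^sub>R k (x - y) \<partial>lborel)) +
        ennreal (norm (\<integral>y. \<omega> y *\<^sub>R core_velocity q (x - y) - \<omega> y *\<^sub>R core_velocity q x \<partial>lborel))"
      by (simp add: norm_triangle_ineq ennreal_leI flip: ennreal_plus)
    also have "\<dots> \<le> V1 x + (\<integral>\<^sup>+y. ennreal (norm (\<omega> y *\<^sub>R core_velocity q (x - y) - \<omega> y *\<^sub>R core_velocity q x)) \<partial>lborel)"
      unfolding V1_eq using 1 2 3
      by (intro add_mono integral_norm_bound_ennreal Bochner_Integration.integrable_diff)
    also have "(\<integral>\<^sup>+y. ennreal (norm (\<omega> y *\<^sub>R core_velocity q (x - y) - \<omega> y *\<^sub>R core_velocity q x)) \<partial>lborel) = V2 x"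
      unfolding V2_def d_def by (simp add: mult.commute flip: scaleR_diff_right)
    finally show ?case
      unfolding split using Bochner_Integration.integrable_add[OF 1 2] by simp
  qed
  then show "AE x in lborel. integrable lborel (\<lambda>y. \<omega> y *\<^sub>R biot_savart_kernel (x - y))"
    by auto
  have "(\<integral>\<^sup>+x. ennreal ((norm (\<integral>y. \<omega> y *\<^sub>R biot_savart_kernel (x - y) \<partial>lborel))\<^sup>2) \<partial>lborel)
      \<le> (\<integral>\<^sup>+x. 2 * (V1 x)\<^sup>2 + 2 * (V2 x)\<^sup>2 \<partial>lborel)"
  proof (rule nn_integral_mono_AE)
    show "AE x in lborel. ennreal ((norm (\<integral>y. \<omega> y *\<^sub>R biot_savart_kernel (x - y) \<partial>lborel))\<^sup>2)
        \<le> 2 * (V1 x)\<^sup>2 + 2 * (V2 x)\<^sup>2"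
      using AE
    proof eventually_elim
      case (elim x)
      then have "(ennreal (norm (\<integral>y. \<omega> y *\<^sub>R biot_savart_kernel (x - y) \<partial>lborel)))\<^sup>2 \<le> (V1 x + V2 x)\<^sup>2"
        by (intro power_mono) auto
      also have "\<dots> \<le> 2 * (V1 x)\<^sup>2 + 2 * (V2 x)\<^sup>2" by (rule ennreal_square_add_le)
      finally show ?case by (simp add: ennreal_power)
    qed
  qed
  also have "\<dots> = 2 * (\<integral>\<^sup>+x. (V1 x)\<^sup>2 \<partial>lborel) + 2 * (\<integral>\<^sup>+x. (V2 x)\<^sup>2 \<partial>lborel)"
    by (simp add: nn_integral_add nn_integral_cmult)
  also have "\<dots> \<le> 2 * ennreal ((16 / 15 * pi)\<^sup>2 * q * ?A) + 2 * ennreal (8 * pi / (3 * q) * ?M\<^sup>2)"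
    by (intro add_mono mult_left_mono V1 V2) auto
  also have "\<dots> = ennreal (2 * ((16 / 15 * pi)\<^sup>2 * q * ?A)) + ennreal (2 * (8 * pi / (3 * q) * ?M\<^sup>2))"
    by (simp only: ennreal_mult' ennreal_numeral zero_le_numeral)
  also have "\<dots> = ennreal (2 * ((16 / 15 * pi)\<^sup>2 * q * ?A) + 2 * (8 * pi / (3 * q) * ?M\<^sup>2))"
    using q A0 by (subst ennreal_plus) auto
  finally show "(\<integral>\<^sup>+x. ennreal ((norm (\<integral>y. \<omega> y *\<^sub>R biot_savart_kernel (x - y) \<partial>lborel))\<^sup>2) \<partial>lborel) \<le>
      ennreal (2 * (16 / 15 * pi)\<^sup>2 * q * ?A + 16 * pi / (3 * q) * ?M\<^sup>2)"
    by (simp add: mult_ac)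
qed

section \<open>Lebesgue and Borel integrals, and the choice of the core radius\<close>

lemma
  fixes f g :: "'a::euclidean_space \<Rightarrow> 'b::euclidean_space"
  assumes f: "f \<in> borel_measurable lebesgue" and g: "g \<in> borel_measurable borel"
    and eq: "AE x in lborel. f x = g x"
  shows integrable_lebesgue_cong_lborel: "integrable lebesgue f \<longleftrightarrow> integrable lborel g"
    and integral_lebesgue_cong_lborel: "(\<integral>x. f x \<partial>lebesgue) = (\<integral>x. g x \<partial>lborel)"
proof -
  have g1: "g \<in> borel_measurable lborel" "g \<in> borel_measurable lebesgue"
    using g by (simp_all add: measurable_completion)
  have eq': "AE x in lebesgue. f x = g x" by (rule AE_completion[OF eq])
  show "integrable lebesgue f \<longleftrightarrow> integrable lborel g"
    using integrable_cong_AE[OF f g1(2) eq'] integrable_completion[OF g1(1)] by simp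
  show "(\<integral>x. f x \<partial>lebesgue) = (\<integral>x. g x \<partial>lborel)"
    using integral_cong_AE[OF f g1(2) eq'] integral_completion[OF g1(1)] by simp
qed

text \<open>Any fixed q gives finiteness; the strict bound takes q adapted to the vorticity, for
  which both of its norms must be positive. The factor 4 * pi^2 accounts for the normalization
  missing from \<open>biot_savart_kernel\<close>.\<close>

lemma biot_savart_energy_bound:
  fixes \<omega> :: "real ^ 2 \<Rightarrow> real"
  assumes [measurable]: "\<omega> \<in> borel_measurable borel"
    and sq: "integrable lborel (\<lambda>x. (\<omega> x)\<^sup>2)" and mom: "integrable lborel (\<lambda>x. norm x * \<bar>\<omega> x\<bar>)"
    and zero: "(\<integral>x. \<omega> x \<partial>lborel) = 0"
  defines "v \<equiv> \<lambda>x. \<integral>y. \<omega> y *\<^sub>R biot_savart_kernel (x - y) \<partial>lborel"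
  shows "v \<in> borel_measurable borel" and "integrable lborel (\<lambda>x. (norm (v x))\<^sup>2)"
    and "\<not> (AE x in lborel. \<omega> x = 0) \<Longrightarrow> (\<integral>x. (norm (v x))\<^sup>2 \<partial>lborel) <
      4 * pi\<^sup>2 * (sqrt (\<integral>x. (\<omega> x)\<^sup>2 \<partial>lborel) * (\<integral>x. norm x * \<bar>\<omega> x\<bar> \<partial>lborel))"
proof -
  let ?A = "\<integral>x. (\<omega> x)\<^sup>2 \<partial>lborel" and ?M = "\<integral>x. norm x * \<bar>\<omega> x\<bar> \<partial>lborel"
  show v[measurable]: "v \<in> borel_measurable borel" unfolding v_def by measurable
  have bound: "(\<integral>\<^sup>+x. ennreal ((norm (v x))\<^sup>2) \<partial>lborel) \<le>
      ennreal (2 * (16 / 15 * pi)\<^sup>2 * q * ?A + 16 * pi / (3 * q) * ?M\<^sup>2)" if "0 < q" for q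
    unfolding v_def by (rule biot_savart_split_bound(2)[OF assms(1) sq mom zero that])
  show int: "integrable lborel (\<lambda>x. (norm (v x))\<^sup>2)"
  proof (rule integrableI_bounded)
    show "(\<integral>\<^sup>+x. ennreal (norm ((norm (v x))\<^sup>2)) \<partial>lborel) < \<infinity>"
      using le_less_trans[OF bound[of 1] ennreal_less_top] by simp
  qed simp
  assume nz: "\<not> (AE x in lborel. \<omega> x = 0)"
  have "?A \<noteq> 0"
    using nz integral_nonneg_eq_0_iff_AE[OF sq] by auto
  then have A: "0 < ?A" by (simp add: order.strict_iff_order)
  have "?M \<noteq> 0"
  proof
    assume "?M = 0"
    then have "AE x in lborel. norm x * \<bar>\<omega> x\<bar> = 0"
      using integral_nonneg_eq_0_iff_AE[OF mom] by auto
    with AE_lborel_singleton[of 0] have "AE x in lborel. \<omega> x = 0"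
      by eventually_elim auto
    with nz show False by simp
  qed
  then have M: "0 < ?M" by (simp add: order.strict_iff_order)
  define a where "a = sqrt ?A"
  have a: "0 < a" "?A = a\<^sup>2" using A by (simp_all add: a_def)
  \<comment> \<open>13/15 is a rational approximation of the optimal factor $\frac{15}{16}\sqrt{8/(3\pi)}$;
    the resulting bound still needs $\pi > 3.04$.\<close>
  define q where "q = 13 / 15 * ?M / a"
  have q: "0 < q" using a M by (simp add: q_def)
  have "ennreal (\<integral>x. (norm (v x))\<^sup>2 \<partial>lborel) \<le> ennreal (2 * (16 / 15 * pi)\<^sup>2 * q * ?A + 16 * pi / (3 * q) * ?M\<^sup>2)"
    using bound[OF q] nn_integral_eq_integral[OF int] by simp
  then have "(\<integral>x. (norm (v x))\<^sup>2 \<partial>lborel) \<le> 2 * (16 / 15 * pi)\<^sup>2 * q * ?A + 16 * pi / (3 * q) * ?M\<^sup>2"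
    using q by (subst (asm) ennreal_le_iff) auto
  \<comment> \<open>6656/3375 = 2 * (16/15)^2 * 13/15 and 80/13 = 16/3 * 15/13. The two summands
    nearly agree, as they would exactly at the optimal q.\<close>
  also have "\<dots> = (6656 / 3375 * pi + 80 / 13) * (pi * (a * ?M))"
  proof -
    have "q * ?A = 13 / 15 * (a * ?M)"
      using a(1) unfolding a(2) q_def by (simp add: power2_eq_square)
    then have p: "2 * (16 / 15 * pi)\<^sup>2 * q * ?A = 6656 / 3375 * pi * (pi * (a * ?M))"
      by (simp add: power2_eq_square algebra_simps)
    have r: "1 / q * ?M\<^sup>2 = 15 / 13 * (a * ?M)"
      using a(1) M unfolding q_def by (simp add: power2_eq_square)
    have "16 * pi / (3 * q) * ?M\<^sup>2 = 16 * pi / 3 * (1 / q * ?M\<^sup>2)"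
      by simp
    also have "\<dots> = 80 / 13 * (pi * (a * ?M))"
      unfolding r by simp
    finally have "16 * pi / (3 * q) * ?M\<^sup>2 = 80 / 13 * (pi * (a * ?M))" .
    with p show ?thesis by (simp add: algebra_simps)
  qed
  also have "\<dots> < (4 * pi) * (pi * (a * ?M))"
  proof (rule mult_strict_right_mono)
    show "6656 / 3375 * pi + 80 / 13 < 4 * pi" using pi_approx(1) by simp
    show "0 < pi * (a * ?M)" using a M by simp
  qed
  finally show "(\<integral>x. (norm (v x))\<^sup>2 \<partial>lborel) < 4 * pi\<^sup>2 * (sqrt ?A * ?M)"
    by (simp add: a_def power2_eq_square mult_ac)
qed

theorem lemmaA1:
  fixes \<omega> :: "real ^ 2 \<Rightarrow> real" and u :: "real ^ 2 \<Rightarrow> real ^ 2"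
  assumes L2: "square_integrable \<omega>"
    and moment: "integrable lebesgue (\<lambda>x. norm x * \<bar>\<omega> x\<bar>)"
    and mean_zero: "(\<integral>x. \<omega> x \<partial>lebesgue) = 0"
    and u: "u = biot_savart \<omega>"
  shows "(AE x in lebesgue. integrable lebesgue
            (\<lambda>y. \<omega> y *\<^sub>R ((1 / (norm (x - y))\<^sup>2) *\<^sub>R perp (x - y))))
    \<and> square_integrable u
    \<and> (\<not> (AE x in lebesgue. \<omega> x = 0) \<longrightarrow>
         L2_norm u < sqrt (L2_norm \<omega>) * sqrt (\<integral>x. norm x * \<bar>\<omega> x\<bar> \<partial>lebesgue))
    \<and> ((AE x in lebesgue. \<omega> x = 0) \<longrightarrow>
         L2_norm u = 0 \<and> sqrt (L2_norm \<omega>) * sqrt (\<integral>x. norm x * \<bar>\<omega> x\<bar> \<partial>lebesgue) = 0)"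
proof -
  obtain w where w [measurable]: "w \<in> borel_measurable borel" and eq: "AE x in lborel. \<omega> x = w x"
    using completion_ex_borel_measurable_real[of \<omega> lborel] L2 by (auto simp: square_integrable_def)
  have \<omega>: "\<omega> \<in> borel_measurable lebesgue"
    using L2 by (simp add: square_integrable_def)
  have eq_sq: "AE x in lborel. (norm (\<omega> x))\<^sup>2 = (w x)\<^sup>2"
    and eq_mom: "AE x in lborel. norm x * \<bar>\<omega> x\<bar> = norm x * \<bar>w x\<bar>"
    using eq by (eventually_elim, simp)+
  have sq_meas: "(\<lambda>x. (norm (\<omega> x))\<^sup>2) \<in> borel_measurable lebesgue"
    and mom_meas: "(\<lambda>x. norm x * \<bar>\<omega> x\<bar>) \<in> borel_measurable lebesgue"
    using L2 moment by (auto simp: square_integrable_def)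
  have sq: "integrable lborel (\<lambda>x. (w x)\<^sup>2)"
    using integrable_lebesgue_cong_lborel[OF sq_meas _ eq_sq] L2 by (simp add: square_integrable_def)
  have sq_eq: "(\<integral>x. (norm (\<omega> x))\<^sup>2 \<partial>lebesgue) = (\<integral>x. (w x)\<^sup>2 \<partial>lborel)"
    by (rule integral_lebesgue_cong_lborel[OF sq_meas _ eq_sq]) measurable
  have \<omega>_L2: "L2_norm \<omega> = sqrt (\<integral>x. (w x)\<^sup>2 \<partial>lborel)"
    by (simp only: L2_norm_def sq_eq)
  have mom: "integrable lborel (\<lambda>x. norm x * \<bar>w x\<bar>)"
    using integrable_lebesgue_cong_lborel[OF mom_meas _ eq_mom] moment by simp
  have mom_eq: "(\<integral>x. norm x * \<bar>\<omega> x\<bar> \<partial>lebesgue) = (\<integral>x. norm x * \<bar>w x\<bar> \<partial>lborel)"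
    by (rule integral_lebesgue_cong_lborel[OF mom_meas _ eq_mom]) measurable
  have zero: "(\<integral>x. w x \<partial>lborel) = 0"
    using integral_lebesgue_cong_lborel[OF \<omega> w eq] mean_zero by simp
  define v where "v x = (\<integral>y. w y *\<^sub>R biot_savart_kernel (x - y) \<partial>lborel)" for x
  have K_meas: "(\<lambda>y. \<omega> y *\<^sub>R ((1 / (norm (x - y))\<^sup>2) *\<^sub>R perp (x - y))) \<in> borel_measurable lebesgue" for x
    by (intro borel_measurable_scaleR \<omega> measurable_completion) measurable
  have K_eq: "AE y in lborel. \<omega> y *\<^sub>R ((1 / (norm (x - y))\<^sup>2) *\<^sub>R perp (x - y)) = w y *\<^sub>R biot_savart_kernel (x - y)" for x
    using eq by eventually_elim (simp add: biot_savart_kernel_def)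
  \<comment> \<open>This holds at every \<open>x\<close>, since changing the vorticity on a null set
    affects neither convergence nor value of the integral; the default value 0 is covered as well.
    Hence \<open>u\<close> is Borel measurable.\<close>
  have u_eq: "u x = (1 / (2 * pi)) *\<^sub>R v x" for x
    unfolding u biot_savart_def v_def
    by (subst integral_lebesgue_cong_lborel[OF K_meas _ K_eq]) measurable
  note bound = biot_savart_energy_bound[OF w sq mom zero]
  have [measurable]: "v \<in> borel_measurable borel"
    using bound(1) unfolding v_def .
  have v_int: "integrable lborel (\<lambda>x. (norm (v x))\<^sup>2)"
    using bound(2) unfolding v_def .
  have "u = (\<lambda>x. (1 / (2 * pi)) *\<^sub>R v x)" by (simp add: fun_eq_iff u_eq)
  then have [measurable]: "u \<in> borel_measurable borel" by simp
  have u_sq: "(norm (u x))\<^sup>2 = (norm (v x))\<^sup>2 / (4 * pi\<^sup>2)" for x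
    by (simp add: u_eq power_mult_distrib power_divide)
  have u_int: "integrable lborel (\<lambda>x. (norm (u x))\<^sup>2)"
    unfolding u_sq using v_int by simp
  have u_L2: "L2_norm u = sqrt ((\<integral>x. (norm (v x))\<^sup>2 \<partial>lborel) / (4 * pi\<^sup>2))"
    unfolding L2_norm_def by (subst integral_completion) (simp_all add: u_sq)
  have "AE x in lebesgue. integrable lebesgue (\<lambda>y. \<omega> y *\<^sub>R ((1 / (norm (x - y))\<^sup>2) *\<^sub>R perp (x - y)))"
    \<comment> \<open>Any positive q proves convergence; here q = 1.\<close>
    using biot_savart_split_bound(1)[OF w sq mom zero zero_less_one]
    by (intro AE_completion, eventually_elim) (subst integrable_lebesgue_cong_lborel[OF K_meas _ K_eq], simp_all)
  moreover have "square_integrable u"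
    unfolding square_integrable_def using u_int by (simp add: integrable_completion measurable_completion)
  moreover have "L2_norm u < sqrt (L2_norm \<omega>) * sqrt (\<integral>x. norm x * \<bar>\<omega> x\<bar> \<partial>lebesgue)"
    if "\<not> (AE x in lebesgue. \<omega> x = 0)"
  proof -
    have "\<not> (AE x in lborel. w x = 0)"
    proof
      assume "AE x in lborel. w x = 0"
      with eq have "AE x in lborel. \<omega> x = 0" by eventually_elim simp
      then show False using that AE_completion by blast
    qed
    from bound(3)[OF this] have "(\<integral>x. (norm (v x))\<^sup>2 \<partial>lborel) / (4 * pi\<^sup>2) <
        sqrt (\<integral>x. (w x)\<^sup>2 \<partial>lborel) * (\<integral>x. norm x * \<bar>w x\<bar> \<partial>lborel)"
      unfolding v_def by (simp add: divide_less_eq mult.commute)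
    then show ?thesis
      unfolding u_L2 mom_eq \<omega>_L2 by (simp flip: real_sqrt_mult)
  qed
  moreover have "L2_norm u = 0 \<and> sqrt (L2_norm \<omega>) * sqrt (\<integral>x. norm x * \<bar>\<omega> x\<bar> \<partial>lebesgue) = 0"
    if "AE x in lebesgue. \<omega> x = 0"
  proof -
    from that have "AE x in lborel. \<omega> x = 0" by (simp add: AE_completion_iff)
    with eq have w0: "AE x in lborel. w x = 0" by eventually_elim simp
    have "v x = 0" for x
      unfolding v_def using w0 by (intro integral_eq_zero_AE) auto
    moreover have "(\<integral>x. (w x)\<^sup>2 \<partial>lborel) = 0"
      using w0 by (intro integral_eq_zero_AE) auto
    ultimately show ?thesis by (simp add: u_L2 \<omega>_L2)
  qed
  ultimately show ?thesis by blast
qed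

end
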